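(* Let $\kappa$ be an algebraically closed field, $G$ a group and $\sigma\in pm(G)$ a factor set with $\sigma(g,g^{-1})\in\{0,1\}$ for all $g\in G$. Let $A_4$ be the alternating subgroup of $S_4$, the symmetric group on $\{0,1,2,3\}$. Then for all $(x,y,z)\in G^3$: $$\partial(\sigma)(\gamma\triangleright(x,y,z))=\partial(\sigma)(x,y,z)\quad\text{for all }\gamma\in A_4.$$ Furthermore, $\partial(\sigma)(x,y,z)=0$ if and only if $\partial(\sigma)((0,2)\triangleright(x,y,z))=0$, where $(0,2)$ denotes the transposition. Moreover, if $\partial(\sigma)(x,y,z)\neq0$ then $$\partial(\sigma)((0,2)\triangleright(x,y,z))=\partial(\sigma)(x,y,z)^{-1}.$$
   Context: A partial projective $\sigma$-representation of $G$ in a unital (associative) $\kappa$-algebra $R$ (with $1_R\neq 0$) is a map $\Gamma:G\to R$ for which there is a function $\sigma:G\times G\to\kappa$ (called the factor set) such that for all $g,h\in G$: (i) if $\sigma(g,h)=0$ then $\Gamma(g^{-1})\Gamma(gh)=0$ and $\Gamma(gh)\Gamma(h^{-1})=0$; (ii) if $\Gamma(g)\Gamma(h)=0$ then $\sigma(g,h)=0$; (iii) $\Gamma(1_G)=1_R$; (iv) $\Gamma(g^{-1})\Gamma(g)\Gamma(h)=\sigma(g,h)\Gamma(g^{-1})\Gamma(gh)$; (v) $\Gamma(g)\Gamma(h)\Gamma(h^{-1})=\sigma(g,h)\Gamma(gh)\Gamma(h^{-1})$. The set of all factor sets of $G$ (over all such $R$ and $\Gamma$) is $pm(G)$. $\partial(\sigma):G^3\to\kappa$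 is defined by $\partial(\sigma)(x,y,z)=\sigma(x,y)\,\sigma(xy,z)\,\sigma(z^{-1}y^{-1},x^{-1})\,\sigma(z^{-1},y^{-1})$. The action $\triangleright$ of $S_4$ on $G^3$ is defined as follows: for $(x,y,z)\in G^3$ put $(u_0,u_1,u_2,u_3)=(1,x,xy,xyz)$; for $\gamma\in S_4$ put $v_i=u_{\gamma^{-1}(i)}$ ($i=0,1,2,3$); then $\gamma\triangleright(x,y,z)=(v_0^{-1}v_1,\ v_1^{-1}v_2,\ v_2^{-1}v_3)$. For example $(0,2)\triangleright(x,y,z)=(y^{-1},x^{-1},xyz)$. *)

theory Defs
  imports "HOL-Algebra.Algebraic_Closure" "HOL-Combinatorics.Permutations"
begin

text \<open>
  The locale \<^locale>\<open>algebra\<close> of HOL-Algebra requires the algebra to be commutative; the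
  algebras needed here are associative and unital, but in general not commutative.
\<close>

locale unital_algebra = K: field K + A: ring R + M: module K R
  for K :: "('k, 'c) ring_scheme" (structure) and R :: "('k, 'r, 'd) module_scheme" (structure) +
  assumes smult_mult_left:
      "\<lbrakk>a \<in> carrier K; x \<in> carrier R; y \<in> carrier R\<rbrakk> \<Longrightarrow>
        (a \<odot>\<^bsub>R\<^esub> x) \<otimes>\<^bsub>R\<^esub> y = a \<odot>\<^bsub>R\<^esub> (x \<otimes>\<^bsub>R\<^esub> y)"
    and smult_mult_right:
      "\<lbrakk>a \<in> carrier K; x \<in> carrier R; y \<in> carrier R\<rbrakk> \<Longrightarrow>
        x \<otimes>\<^bsub>R\<^esub> (a \<odot>\<^bsub>R\<^esub> y) = a \<odot>\<^bsub>R\<^esub> (x \<otimes>\<^bsub>R\<^esub> y)"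
    and one_neq_zero: "\<one>\<^bsub>R\<^esub> \<noteq> \<zero>\<^bsub>R\<^esub>"

locale partial_projective_rep = G: group G + unital_algebra K R
  for G :: "('g, 'b) monoid_scheme" (structure)
    and K :: "('k, 'c) ring_scheme" (structure)
    and R :: "('k, 'r, 'd) module_scheme" (structure) +
  fixes \<Gamma> :: "'g \<Rightarrow> 'r" and \<sigma> :: "'g \<Rightarrow> 'g \<Rightarrow> 'k"
  assumes Gamma_closed: "\<Gamma> \<in> carrier G \<rightarrow> carrier R"
    and factor_closed: "\<sigma> \<in> carrier G \<rightarrow> carrier G \<rightarrow> carrier K"
    and factor_zero_left:
      "\<lbrakk>g \<in> carrier G; h \<in> carrier G; \<sigma> g h = \<zero>\<^bsub>K\<^esub>\<rbrakk> \<Longrightarrow>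
        \<Gamma> (inv\<^bsub>G\<^esub> g) \<otimes>\<^bsub>R\<^esub> \<Gamma> (g \<otimes>\<^bsub>G\<^esub> h) = \<zero>\<^bsub>R\<^esub>"
    and factor_zero_right:
      "\<lbrakk>g \<in> carrier G; h \<in> carrier G; \<sigma> g h = \<zero>\<^bsub>K\<^esub>\<rbrakk> \<Longrightarrow>
        \<Gamma> (g \<otimes>\<^bsub>G\<^esub> h) \<otimes>\<^bsub>R\<^esub> \<Gamma> (inv\<^bsub>G\<^esub> h) = \<zero>\<^bsub>R\<^esub>"
    and factor_zeroI:
      "\<lbrakk>g \<in> carrier G; h \<in> carrier G; \<Gamma> g \<otimes>\<^bsub>R\<^esub> \<Gamma> h = \<zero>\<^bsub>R\<^esub>\<rbrakk> \<Longrightarrow> \<sigma> g h = \<zero>\<^bsub>K\<^esub>"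
    and Gamma_one: "\<Gamma> \<one>\<^bsub>G\<^esub> = \<one>\<^bsub>R\<^esub>"
    and Gamma_mult_left:
      "\<lbrakk>g \<in> carrier G; h \<in> carrier G\<rbrakk> \<Longrightarrow>
        \<Gamma> (inv\<^bsub>G\<^esub> g) \<otimes>\<^bsub>R\<^esub> \<Gamma> g \<otimes>\<^bsub>R\<^esub> \<Gamma> h =
        \<sigma> g h \<odot>\<^bsub>R\<^esub> (\<Gamma> (inv\<^bsub>G\<^esub> g) \<otimes>\<^bsub>R\<^esub> \<Gamma> (g \<otimes>\<^bsub>G\<^esub> h))"
    and Gamma_mult_right:
      "\<lbrakk>g \<in> carrier G; h \<in> carrier G\<rbrakk> \<Longrightarrow>
        \<Gamma> g \<otimes>\<^bsub>R\<^esub> \<Gamma> h \<otimes>\<^bsub>R\<^esub> \<Gamma> (inv\<^bsub>G\<^esub> h) =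
        \<sigma> g h \<odot>\<^bsub>R\<^esub> (\<Gamma> (g \<otimes>\<^bsub>G\<^esub> h) \<otimes>\<^bsub>R\<^esub> \<Gamma> (inv\<^bsub>G\<^esub> h))"

text \<open>
  HOL cannot quantify over the type of the algebra inside a formula, so it is a parameter of
  \<open>pm\<close>. A theorem assuming \<open>\<sigma> \<in> pm TYPE('r) G K\<close> with \<open>'r\<close> a type variable covers the factor
  sets arising from all algebras. Values of a factor set outside \<^term>\<open>carrier G\<close> are arbitrary.
\<close>

definition pm ::
    "'r itself \<Rightarrow> ('g, 'b) monoid_scheme \<Rightarrow> ('k, 'c) ring_scheme \<Rightarrow> ('g \<Rightarrow> 'g \<Rightarrow> 'k) set" where
  "pm TYPE('r) G K =
    {\<sigma>. \<exists>(R :: ('k, 'r) module) \<Gamma>. partial_projective_rep G K R \<Gamma> \<sigma>}"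

definition bd ::
    "('g, 'b) monoid_scheme \<Rightarrow> ('k, 'c) ring_scheme \<Rightarrow> ('g \<Rightarrow> 'g \<Rightarrow> 'k) \<Rightarrow> 'g \<times> 'g \<times> 'g \<Rightarrow> 'k" where
  "bd G K \<sigma> = (\<lambda>(x, y, z).
      \<sigma> x y \<otimes>\<^bsub>K\<^esub> \<sigma> (x \<otimes>\<^bsub>G\<^esub> y) z
      \<otimes>\<^bsub>K\<^esub> \<sigma> (inv\<^bsub>G\<^esub> z \<otimes>\<^bsub>G\<^esub> inv\<^bsub>G\<^esub> y) (inv\<^bsub>G\<^esub> x)
      \<otimes>\<^bsub>K\<^esub> \<sigma> (inv\<^bsub>G\<^esub> z) (inv\<^bsub>G\<^esub> y))"

definition S4_act ::
    "('g, 'b) monoid_scheme \<Rightarrow> (nat \<Rightarrow> nat) \<Rightarrow> 'g \<times> 'g \<times> 'g \<Rightarrow> 'g \<times> 'g \<times> 'g" where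
  "S4_act G \<gamma> = (\<lambda>(x, y, z).
    let u = (\<lambda>i. [\<one>\<^bsub>G\<^esub>, x, x \<otimes>\<^bsub>G\<^esub> y, x \<otimes>\<^bsub>G\<^esub> y \<otimes>\<^bsub>G\<^esub> z] ! i);
        v = (\<lambda>i. u (Hilbert_Choice.inv \<gamma> i))
    in (inv\<^bsub>G\<^esub> (v 0) \<otimes>\<^bsub>G\<^esub> v 1, inv\<^bsub>G\<^esub> (v 1) \<otimes>\<^bsub>G\<^esub> v 2, inv\<^bsub>G\<^esub> (v 2) \<otimes>\<^bsub>G\<^esub> v 3))"

definition S4 :: "(nat \<Rightarrow> nat) set" where
  "S4 = {\<gamma>. \<gamma> permutes {0, 1, 2, 3}}"

definition A4 :: "(nat \<Rightarrow> nat) set" where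
  "A4 = {\<gamma> \<in> S4. evenperm \<gamma>}"

lemma (in group) S4_act_transpose_0_2:
  assumes "x \<in> carrier G" "y \<in> carrier G" "z \<in> carrier G"
  shows "S4_act G (Transposition.transpose 0 2) (x, y, z) = (inv y, inv x, x \<otimes> y \<otimes> z)"
proof -
  have "inv (x \<otimes> y) \<otimes> x = inv y"
    using assms by (simp add: inv_mult_group m_assoc)
  then show ?thesis
    using assms by (simp add: S4_act_def Let_def transpose_def inv_mult_group)
qed

end

theory Submission
  imports Defs
begin

text \<open>
  The elements \<open>\<epsilon> g = \<Gamma> g * \<Gamma> (inv g)\<close> are commuting idempotents with
  \<open>\<Gamma> g * \<Gamma> h = \<sigma> g h \<epsilon> g \<Gamma> (g * h) = \<sigma> g h \<Gamma> (g * h) \<epsilon> (inv h)\<close>, and \<open>\<sigma> g h\<close> vanishes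
  exactly if \<open>\<epsilon> g * \<epsilon> (g * h)\<close> does. Attach to an oriented triangle with vertices \<open>a, b, c\<close> in the
  group the scalar \<open>w a b c = \<sigma> (inv a * b) (inv b * c)\<close>. Comparing products of two and
  three values of \<open>\<Gamma>\<close> shows that \<open>w\<close> is invariant under rotation and that reversing the
  orientation inverts it, where zero counts as its own inverse. Now \<open>\<partial>\<sigma>\<close> is the product of \<open>w\<close>
  over the coherently oriented faces of the tetrahedron \<open>1, x, xy, xyz\<close>, so every
  transposition of its vertices inverts it.
\<close>

section \<open>Cancelling scalars against nonzero elements of an algebra\<close>

context unital_algebra
begin

lemma smult_eq_zero_imp:
  assumes "a \<in> carrier K" "x \<in> carrier R" "x \<noteq> \<zero>\<^bsub>R\<^esub>" "a \<odot>\<^bsub>R\<^esub> x = \<zero>\<^bsub>R\<^esub>"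
  shows "a = \<zero>\<^bsub>K\<^esub>"
proof (rule ccontr)
  assume "a \<noteq> \<zero>\<^bsub>K\<^esub>"
  then have u: "a \<in> Units K"
    using assms by (simp add: K.field_Units)
  have "x = (inv\<^bsub>K\<^esub> a \<otimes>\<^bsub>K\<^esub> a) \<odot>\<^bsub>R\<^esub> x"
    using u assms by simp
  also have "\<dots> = inv\<^bsub>K\<^esub> a \<odot>\<^bsub>R\<^esub> (a \<odot>\<^bsub>R\<^esub> x)"
    using u assms by (intro M.smult_assoc1) auto
  also have "\<dots> = \<zero>\<^bsub>R\<^esub>"
    using u assms by simp
  finally show False
    using assms by simp
qed

lemma smult_cancel:
  assumes "a \<in> carrier K" "b \<in> carrier K" "x \<in> carrier R" "x \<noteq> \<zero>\<^bsub>R\<^esub>"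
    and "a \<odot>\<^bsub>R\<^esub> x = b \<odot>\<^bsub>R\<^esub> x"
  shows "a = b"
proof -
  have "(a \<ominus>\<^bsub>K\<^esub> b) \<odot>\<^bsub>R\<^esub> x = \<zero>\<^bsub>R\<^esub>"
    using assms by (simp add: a_minus_def M.smult_l_distr M.smult_l_minus A.r_neg)
  then have "a \<ominus>\<^bsub>K\<^esub> b = \<zero>\<^bsub>K\<^esub>"
    using assms by (intro smult_eq_zero_imp [of _ x]) auto
  then show ?thesis
    using assms by simp
qed

lemma smult_fixed_imp_one:
  assumes "a \<in> carrier K" "x \<in> carrier R" "x \<noteq> \<zero>\<^bsub>R\<^esub>" "a \<odot>\<^bsub>R\<^esub> x = x"
  shows "a = \<one>\<^bsub>K\<^esub>"
  using assms by (intro smult_cancel [of a _ x]) auto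

lemma smult_mult_smult:
  assumes "a \<in> carrier K" "b \<in> carrier K" "x \<in> carrier R" "y \<in> carrier R"
  shows "(a \<odot>\<^bsub>R\<^esub> x) \<otimes>\<^bsub>R\<^esub> (b \<odot>\<^bsub>R\<^esub> y) = (a \<otimes>\<^bsub>K\<^esub> b) \<odot>\<^bsub>R\<^esub> (x \<otimes>\<^bsub>R\<^esub> y)"
  using assms by (subst smult_mult_left) (simp_all add: smult_mult_right M.smult_assoc1)

end

section \<open>The commuting idempotents of a normalized representation\<close>

locale normalized_partial_projective_rep = partial_projective_rep +
  assumes factor_inv: "g \<in> carrier G \<Longrightarrow> \<sigma> g (inv g) \<in> {\<zero>\<^bsub>K\<^esub>, \<one>\<^bsub>K\<^esub>}"
begin

definition \<epsilon> where "\<epsilon> g = \<Gamma> g \<otimes>\<^bsub>R\<^esub> \<Gamma> (inv g)"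

lemma Gamma_in [simp]: "g \<in> carrier G \<Longrightarrow> \<Gamma> g \<in> carrier R"
  using Gamma_closed by blast

lemma factor_in [simp]: "g \<in> carrier G \<Longrightarrow> h \<in> carrier G \<Longrightarrow> \<sigma> g h \<in> carrier K"
  using factor_closed by blast

lemma eps_in [simp]: "g \<in> carrier G \<Longrightarrow> \<epsilon> g \<in> carrier R"
  by (simp add: \<epsilon>_def)

text \<open>The normalization enters here: the left multiplication axiom for the pair
  \<open>inv g\<close>, \<open>g\<close> gives \<open>\<Gamma> g * \<Gamma> (inv g) * \<Gamma> g =
  \<sigma> (inv g) g * \<Gamma> g\<close>. The scalar is one, or it is zero and then
  \<open>\<Gamma> g\<close> itself vanishes.\<close>

lemma eps_Gamma [simp]:
  assumes "g \<in> carrier G"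
  shows "\<epsilon> g \<otimes>\<^bsub>R\<^esub> \<Gamma> g = \<Gamma> g"
proof (cases "\<sigma> (inv g) g = \<zero>\<^bsub>K\<^esub>")
  case True
  then have "\<Gamma> g = \<zero>\<^bsub>R\<^esub>"
    using assms factor_zero_left [of "inv g" g] Gamma_one by simp
  then show ?thesis
    using assms by simp
next
  case False
  then have "\<sigma> (inv g) g = \<one>\<^bsub>K\<^esub>"
    using assms factor_inv [of "inv g"] by simp
  then show ?thesis
    using assms Gamma_mult_left [of "inv g" g] Gamma_one by (simp add: \<epsilon>_def)
qed

lemma Gamma_eps [simp]: "g \<in> carrier G \<Longrightarrow> \<Gamma> g \<otimes>\<^bsub>R\<^esub> \<epsilon> (inv g) = \<Gamma> g"
  using eps_Gamma [of g] by (simp add: \<epsilon>_def A.m_assoc)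

lemma eps_idem [simp]: "g \<in> carrier G \<Longrightarrow> \<epsilon> g \<otimes>\<^bsub>R\<^esub> \<epsilon> g = \<epsilon> g"
  using eps_Gamma [of g] by (simp add: \<epsilon>_def A.m_assoc [symmetric])

text \<open>Replacing \<open>\<Gamma> g\<close> by
  \<open>\<Gamma> g * \<Gamma> (inv g) * \<Gamma> g\<close> creates the left-hand side of the axiom
  \<open>Gamma_mult_left\<close>.\<close>

lemma Gamma_mult_eps_left:
  assumes "g \<in> carrier G" "h \<in> carrier G"
  shows "\<Gamma> g \<otimes>\<^bsub>R\<^esub> \<Gamma> h = \<sigma> g h \<odot>\<^bsub>R\<^esub> (\<epsilon> g \<otimes>\<^bsub>R\<^esub> \<Gamma> (g \<otimes> h))"
proof -
  have "\<Gamma> g \<otimes>\<^bsub>R\<^esub> \<Gamma> h = \<Gamma> g \<otimes>\<^bsub>R\<^esub> (\<Gamma> (inv g) \<otimes>\<^bsub>R\<^esub> \<Gamma> g \<otimes>\<^bsub>R\<^esub> \<Gamma> h)"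
    using assms eps_Gamma [of g] by (simp add: \<epsilon>_def A.m_assoc [symmetric])
  also have "\<dots> = \<sigma> g h \<odot>\<^bsub>R\<^esub> (\<epsilon> g \<otimes>\<^bsub>R\<^esub> \<Gamma> (g \<otimes> h))"
    unfolding Gamma_mult_left [OF assms]
    using assms by (simp add: smult_mult_right \<epsilon>_def A.m_assoc)
  finally show ?thesis .
qed

lemma Gamma_mult_eps_right:
  assumes "g \<in> carrier G" "h \<in> carrier G"
  shows "\<Gamma> g \<otimes>\<^bsub>R\<^esub> \<Gamma> h = \<sigma> g h \<odot>\<^bsub>R\<^esub> (\<Gamma> (g \<otimes> h) \<otimes>\<^bsub>R\<^esub> \<epsilon> (inv h))"
proof -
  have "\<Gamma> g \<otimes>\<^bsub>R\<^esub> \<Gamma> h = \<Gamma> g \<otimes>\<^bsub>R\<^esub> \<Gamma> h \<otimes>\<^bsub>R\<^esub> \<Gamma> (inv h) \<otimes>\<^bsub>R\<^esub> \<Gamma> h"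
    using assms eps_Gamma [of h] by (simp add: \<epsilon>_def A.m_assoc)
  also have "\<dots> = \<sigma> g h \<odot>\<^bsub>R\<^esub> (\<Gamma> (g \<otimes> h) \<otimes>\<^bsub>R\<^esub> \<epsilon> (inv h))"
    unfolding Gamma_mult_right [OF assms]
    using assms by (simp add: smult_mult_left \<epsilon>_def A.m_assoc)
  finally show ?thesis .
qed

text \<open>
  The two sides \<open>X\<close> and \<open>Y\<close> satisfy \<open>X = c X = c Y\<close> and \<open>Y = d X\<close> for scalars \<open>c\<close> and \<open>d\<close>, so
  either \<open>c\<close> is one or both sides vanish.
\<close>

lemma eps_Gamma_commute:
  assumes g: "g \<in> carrier G" and h: "h \<in> carrier G"
  shows "\<epsilon> g \<otimes>\<^bsub>R\<^esub> \<Gamma> h = \<Gamma> h \<otimes>\<^bsub>R\<^esub> \<epsilon> (inv h \<otimes> g)"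
proof -
  define k where "k = inv h \<otimes> g"
  have k: "k \<in> carrier G" "inv k = inv g \<otimes> h" "h \<otimes> k = g" "g \<otimes> inv k = h"
    using g h by (simp_all add: k_def G.inv_mult_group G.m_assoc [symmetric])
  let ?X = "\<epsilon> g \<otimes>\<^bsub>R\<^esub> \<Gamma> h" and ?Y = "\<Gamma> h \<otimes>\<^bsub>R\<^esub> \<epsilon> k"
  have 1: "\<Gamma> g \<otimes>\<^bsub>R\<^esub> \<Gamma> (inv k) = \<sigma> g (inv k) \<odot>\<^bsub>R\<^esub> ?X"
    using Gamma_mult_eps_left [of g "inv k", unfolded k(4)] g k(1) by simp
  have 2: "\<Gamma> g \<otimes>\<^bsub>R\<^esub> \<Gamma> (inv k) = \<sigma> g (inv k) \<odot>\<^bsub>R\<^esub> ?Y"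
    using Gamma_mult_eps_right [of g "inv k", unfolded k(4)] g k(1) by simp
  have X: "?X = \<sigma> (inv g) h \<odot>\<^bsub>R\<^esub> (\<Gamma> g \<otimes>\<^bsub>R\<^esub> \<Gamma> (inv k))"
    using Gamma_mult_left [of "inv g" h] g h k by (simp add: \<epsilon>_def)
  have Y: "?Y = \<sigma> h k \<odot>\<^bsub>R\<^esub> (\<Gamma> g \<otimes>\<^bsub>R\<^esub> \<Gamma> (inv k))"
    using Gamma_mult_right [of h k] g h k(1,3) by (simp add: \<epsilon>_def A.m_assoc)
  have "?X = ?Y"
  proof (cases "?X = \<zero>\<^bsub>R\<^esub>")
    case True
    have "?Y = \<sigma> h k \<odot>\<^bsub>R\<^esub> (\<sigma> g (inv k) \<odot>\<^bsub>R\<^esub> ?X)"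
      using Y unfolding 1 .
    then show ?thesis
      using True g h k(1) by simp
  next
    case False
    let ?c = "\<sigma> (inv g) h \<otimes>\<^bsub>K\<^esub> \<sigma> g (inv k)"
    have c: "?c \<in> carrier K"
      using g h k(1) by simp
    have "?c \<odot>\<^bsub>R\<^esub> ?X = ?X"
      using X [unfolded 1] g h k(1) by (simp add: M.smult_assoc1)
    then have "?c = \<one>\<^bsub>K\<^esub>"
      using False c g h by (intro smult_fixed_imp_one) auto
    moreover have "?X = ?c \<odot>\<^bsub>R\<^esub> ?Y"
      using X [unfolded 2] g h k(1) by (simp add: M.smult_assoc1)
    ultimately show ?thesis
      using g h k(1) by simp
  qed
  then show ?thesis
    by (simp add: k_def)
qed

lemma Gamma_eps_commute:
  assumes "g \<in> carrier G" "h \<in> carrier G"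
  shows "\<Gamma> g \<otimes>\<^bsub>R\<^esub> \<epsilon> h = \<epsilon> (g \<otimes> h) \<otimes>\<^bsub>R\<^esub> \<Gamma> g"
  using eps_Gamma_commute [of "g \<otimes> h" g] assms by (simp add: G.m_assoc [symmetric])

text \<open>Moving \<open>\<Gamma> g\<close> to the right past \<open>\<epsilon> h\<close>
  translates the index by \<open>g\<close> and leaves \<open>\<Gamma> g * \<Gamma> (inv g)\<close>
  behind.\<close>

lemma Gamma_eps_Gamma_inv:
  assumes "g \<in> carrier G" "h \<in> carrier G"
  shows "\<Gamma> g \<otimes>\<^bsub>R\<^esub> \<epsilon> h \<otimes>\<^bsub>R\<^esub> \<Gamma> (inv g) = \<epsilon> (g \<otimes> h) \<otimes>\<^bsub>R\<^esub> \<epsilon> g"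
  using assms by (simp add: Gamma_eps_commute A.m_assoc) (simp add: \<epsilon>_def)

text \<open>With \<open>g = h * k\<close>, both products equal
  \<open>\<Gamma> h * \<epsilon> k * \<Gamma> (inv h)\<close>: the inner idempotent may leave to the
  left or to the right, and becomes \<open>\<epsilon> g\<close> either way.\<close>

lemma eps_commute:
  assumes "g \<in> carrier G" "h \<in> carrier G"
  shows "\<epsilon> g \<otimes>\<^bsub>R\<^esub> \<epsilon> h = \<epsilon> h \<otimes>\<^bsub>R\<^esub> \<epsilon> g"
proof -
  define k where "k = inv h \<otimes> g"
  have k: "k \<in> carrier G" "h \<otimes> k = g"
    using assms by (simp_all add: k_def G.m_assoc [symmetric])
  have "\<epsilon> g \<otimes>\<^bsub>R\<^esub> \<epsilon> h = \<Gamma> h \<otimes>\<^bsub>R\<^esub> (\<epsilon> k \<otimes>\<^bsub>R\<^esub> \<Gamma> (inv h))"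
    using Gamma_eps_Gamma_inv [of h k] assms k by (simp add: A.m_assoc)
  also have "\<dots> = \<Gamma> h \<otimes>\<^bsub>R\<^esub> (\<Gamma> (inv h) \<otimes>\<^bsub>R\<^esub> \<epsilon> g)"
    using eps_Gamma_commute [of k "inv h"] assms k by simp
  also have "\<dots> = \<epsilon> h \<otimes>\<^bsub>R\<^esub> \<epsilon> g"
    using assms by (simp add: \<epsilon>_def A.m_assoc)
  finally show ?thesis .
qed

section \<open>Vanishing, rotation and reversal of the factor set\<close>

lemma factor_zero_of_eps:
  assumes g: "g \<in> carrier G" and h: "h \<in> carrier G"
    and zero: "\<epsilon> g \<otimes>\<^bsub>R\<^esub> \<epsilon> (g \<otimes> h) = \<zero>\<^bsub>R\<^esub>"
  shows "\<sigma> g h = \<zero>\<^bsub>K\<^esub>"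
proof (rule factor_zeroI [OF g h])
  have "\<epsilon> g \<otimes>\<^bsub>R\<^esub> \<Gamma> (g \<otimes> h) = \<epsilon> g \<otimes>\<^bsub>R\<^esub> \<epsilon> (g \<otimes> h) \<otimes>\<^bsub>R\<^esub> \<Gamma> (g \<otimes> h)"
    using g h by (simp add: A.m_assoc)
  then show "\<Gamma> g \<otimes>\<^bsub>R\<^esub> \<Gamma> h = \<zero>\<^bsub>R\<^esub>"
    using g h zero by (simp add: Gamma_mult_eps_left)
qed

text \<open>In the triangle \<open>1, g, g * h\<close> the edges leaving \<open>1\<close> are
  \<open>g\<close> and \<open>g * h\<close>, those leaving \<open>g\<close> are \<open>h\<close> and
  \<open>inv g\<close>. Conjugation with \<open>\<Gamma> (inv g)\<close> passes from the first
  vertex to the second.\<close>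

lemma eps_mult_eq_zero_rotate:
  assumes g: "g \<in> carrier G" and h: "h \<in> carrier G"
    and zero: "\<epsilon> g \<otimes>\<^bsub>R\<^esub> \<epsilon> (g \<otimes> h) = \<zero>\<^bsub>R\<^esub>"
  shows "\<epsilon> h \<otimes>\<^bsub>R\<^esub> \<epsilon> (inv g) = \<zero>\<^bsub>R\<^esub>"
proof -
  have "\<epsilon> h \<otimes>\<^bsub>R\<^esub> \<epsilon> (inv g) = \<Gamma> (inv g) \<otimes>\<^bsub>R\<^esub> \<epsilon> (g \<otimes> h) \<otimes>\<^bsub>R\<^esub> \<Gamma> g"
    using Gamma_eps_Gamma_inv [of "inv g" "g \<otimes> h"] g h by (simp add: G.m_assoc [symmetric])
  also have "\<dots> = \<Gamma> (inv g) \<otimes>\<^bsub>R\<^esub> (\<epsilon> g \<otimes>\<^bsub>R\<^esub> \<epsilon> (g \<otimes> h)) \<otimes>\<^bsub>R\<^esub> \<Gamma> g"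
    using Gamma_eps [of "inv g"] g h by (simp add: A.m_assoc [symmetric])
  finally show ?thesis
    using g h zero by simp
qed

text \<open>The two bracketings of \<open>\<Gamma> g * \<Gamma> h * \<Gamma> (inv (g * h))\<close>
  are the two factors times the same element \<open>\<epsilon> g * \<epsilon> (g * h)\<close>. If
  that element is zero, both factors vanish.\<close>

lemma factor_rotate:
  assumes g: "g \<in> carrier G" and h: "h \<in> carrier G"
  shows "\<sigma> h (inv h \<otimes> inv g) = \<sigma> g h"
proof (cases "\<epsilon> g \<otimes>\<^bsub>R\<^esub> \<epsilon> (g \<otimes> h) = \<zero>\<^bsub>R\<^esub>")
  case True
  moreover have "\<sigma> h (inv h \<otimes> inv g) = \<zero>\<^bsub>K\<^esub>"
    using eps_mult_eq_zero_rotate [OF g h True] g h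
    by (intro factor_zero_of_eps) (simp_all add: G.m_assoc [symmetric])
  ultimately show ?thesis
    using factor_zero_of_eps g h by simp
next
  case False
  have gh: "inv h \<otimes> inv g = inv (g \<otimes> h)" "h \<otimes> inv (g \<otimes> h) = inv g"
    using g h by (simp_all add: G.inv_mult_group G.m_assoc [symmetric])
  have "\<sigma> g h \<odot>\<^bsub>R\<^esub> (\<epsilon> g \<otimes>\<^bsub>R\<^esub> \<epsilon> (g \<otimes> h)) = \<Gamma> g \<otimes>\<^bsub>R\<^esub> \<Gamma> h \<otimes>\<^bsub>R\<^esub> \<Gamma> (inv (g \<otimes> h))"
    unfolding Gamma_mult_eps_left [OF g h]
    using g h by (simp add: smult_mult_left \<epsilon>_def A.m_assoc)
  also have "\<dots> = \<Gamma> g \<otimes>\<^bsub>R\<^esub> (\<Gamma> h \<otimes>\<^bsub>R\<^esub> \<Gamma> (inv (g \<otimes> h)))"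
    using g h by (simp add: A.m_assoc)
  also have "\<dots> = \<sigma> h (inv (g \<otimes> h)) \<odot>\<^bsub>R\<^esub> (\<Gamma> g \<otimes>\<^bsub>R\<^esub> \<epsilon> h \<otimes>\<^bsub>R\<^esub> \<Gamma> (inv g))"
    using Gamma_mult_eps_left [of h "inv (g \<otimes> h)"] g h gh
    by (simp add: smult_mult_right A.m_assoc)
  also have "\<dots> = \<sigma> h (inv (g \<otimes> h)) \<odot>\<^bsub>R\<^esub> (\<epsilon> g \<otimes>\<^bsub>R\<^esub> \<epsilon> (g \<otimes> h))"
    using Gamma_eps_Gamma_inv [of g h] eps_commute [of g "g \<otimes> h"] g h by simp
  finally show ?thesis
    using smult_cancel [OF _ _ _ False] g h gh
    by (metis A.m_closed G.inv_closed G.m_closed eps_in factor_in)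
qed

text \<open>As a total multiplicative involution of the field, it lets a single equation express
  both that vanishing is preserved and that nonzero values are inverted.\<close>

definition inv0 where "inv0 a = (if a = \<zero>\<^bsub>K\<^esub> then \<zero>\<^bsub>K\<^esub> else inv\<^bsub>K\<^esub> a)"

lemma inv0_closed [simp]: "a \<in> carrier K \<Longrightarrow> inv0 a \<in> carrier K"
  by (auto simp: inv0_def K.field_Units)

lemma inv0_eq_zero_iff [simp]: "a \<in> carrier K \<Longrightarrow> inv0 a = \<zero>\<^bsub>K\<^esub> \<longleftrightarrow> a = \<zero>\<^bsub>K\<^esub>"
  using K.Units_inv_Units [of a] by (auto simp: inv0_def K.field_Units)

lemma inv0_inv0 [simp]: "a \<in> carrier K \<Longrightarrow> inv0 (inv0 a) = a"
  using inv0_eq_zero_iff [of a] by (auto simp: inv0_def K.field_Units)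

lemma inv0_mult [simp]:
  assumes "a \<in> carrier K" "b \<in> carrier K"
  shows "inv0 (a \<otimes>\<^bsub>K\<^esub> b) = inv0 a \<otimes>\<^bsub>K\<^esub> inv0 b"
proof (cases "a = \<zero>\<^bsub>K\<^esub> \<or> b = \<zero>\<^bsub>K\<^esub>")
  case True
  then show ?thesis
    using assms by (auto simp: inv0_def K.field_Units)
next
  case False
  then have u: "a \<in> Units K" "b \<in> Units K"
    using assms by (auto simp: K.field_Units)
  have "a \<otimes>\<^bsub>K\<^esub> b \<otimes>\<^bsub>K\<^esub> (inv\<^bsub>K\<^esub> a \<otimes>\<^bsub>K\<^esub> inv\<^bsub>K\<^esub> b) =
      (a \<otimes>\<^bsub>K\<^esub> inv\<^bsub>K\<^esub> a) \<otimes>\<^bsub>K\<^esub> (b \<otimes>\<^bsub>K\<^esub> inv\<^bsub>K\<^esub> b)"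
    using assms u by (simp only: K.m_ac K.m_closed K.Units_inv_closed)
  also have "\<dots> = \<one>\<^bsub>K\<^esub>"
    using u by simp
  finally have "inv\<^bsub>K\<^esub> (a \<otimes>\<^bsub>K\<^esub> b) = inv\<^bsub>K\<^esub> a \<otimes>\<^bsub>K\<^esub> inv\<^bsub>K\<^esub> b"
    using assms u by (intro K.comm_inv_char) auto
  then show ?thesis
    using False assms by (simp add: inv0_def K.integral_iff)
qed

lemma factor_reverse:
  assumes g: "g \<in> carrier G" and h: "h \<in> carrier G"
  shows "\<sigma> (inv h) (inv g) = inv0 (\<sigma> g h)"
proof (cases "\<epsilon> g \<otimes>\<^bsub>R\<^esub> \<epsilon> (g \<otimes> h) = \<zero>\<^bsub>R\<^esub>")
  case True
  \<comment> \<open>Two rotations lead to the vertex \<open>g * h\<close> of the triangle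
    \<open>1, g, g * h\<close>, the starting vertex of the reversed pair.\<close>
  have "\<epsilon> (inv h) \<otimes>\<^bsub>R\<^esub> \<epsilon> (inv h \<otimes> inv g) = \<zero>\<^bsub>R\<^esub>"
    using eps_mult_eq_zero_rotate [of h "inv h \<otimes> inv g"] eps_mult_eq_zero_rotate [OF g h True] g h
    by (simp add: G.m_assoc [symmetric] eps_commute)
  then show ?thesis
    using factor_zero_of_eps [OF g h True] factor_zero_of_eps [of "inv h" "inv g"] g h
    by (simp add: inv0_def)
next
  case False
  let ?s = "\<sigma> g h" and ?t = "\<sigma> (inv h) (inv g)" and ?p = "\<epsilon> g \<otimes>\<^bsub>R\<^esub> \<epsilon> (g \<otimes> h)"
  have gh: "inv h \<otimes> inv g = inv (g \<otimes> h)"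
    using g h by (simp add: G.inv_mult_group)
  \<comment> \<open>The product \<open>\<Gamma> g * \<Gamma> h * \<Gamma> (inv h) * \<Gamma> (inv
    g)\<close> is evaluated twice: contracting the middle pair gives \<open>?p\<close>, contracting
    the outer pairs gives \<open>?s * ?t\<close> times \<open>?p\<close>.\<close>
  have "?p = \<Gamma> g \<otimes>\<^bsub>R\<^esub> \<epsilon> h \<otimes>\<^bsub>R\<^esub> \<Gamma> (inv g)"
    using g h by (simp add: Gamma_eps_Gamma_inv eps_commute)
  also have "\<dots> = (\<Gamma> g \<otimes>\<^bsub>R\<^esub> \<Gamma> h) \<otimes>\<^bsub>R\<^esub> (\<Gamma> (inv h) \<otimes>\<^bsub>R\<^esub> \<Gamma> (inv g))"
    using g h by (simp add: \<epsilon>_def A.m_assoc)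
  also have "\<dots> = (?s \<odot>\<^bsub>R\<^esub> (\<epsilon> g \<otimes>\<^bsub>R\<^esub> \<Gamma> (g \<otimes> h))) \<otimes>\<^bsub>R\<^esub>
      (?t \<odot>\<^bsub>R\<^esub> (\<Gamma> (inv (g \<otimes> h)) \<otimes>\<^bsub>R\<^esub> \<epsilon> g))"
    using Gamma_mult_eps_left [OF g h] Gamma_mult_eps_right [of "inv h" "inv g"] g h gh by simp
  also have "\<dots> = (?s \<otimes>\<^bsub>K\<^esub> ?t) \<odot>\<^bsub>R\<^esub> (\<epsilon> g \<otimes>\<^bsub>R\<^esub> (\<epsilon> (g \<otimes> h) \<otimes>\<^bsub>R\<^esub> \<epsilon> g))"
    using g h by (simp add: smult_mult_smult A.m_assoc) (simp add: \<epsilon>_def A.m_assoc)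
  also have "\<epsilon> g \<otimes>\<^bsub>R\<^esub> (\<epsilon> (g \<otimes> h) \<otimes>\<^bsub>R\<^esub> \<epsilon> g) = ?p"
    using eps_commute [of "g \<otimes> h" g] g h by (simp add: A.m_assoc [symmetric])
  finally have fixed: "(?s \<otimes>\<^bsub>K\<^esub> ?t) \<odot>\<^bsub>R\<^esub> ?p = ?p"
    by (rule sym)
  have "?s \<otimes>\<^bsub>K\<^esub> ?t = \<one>\<^bsub>K\<^esub>"
    by (rule smult_fixed_imp_one [OF _ _ False fixed]) (use g h in simp_all)
  then show ?thesis
    using g h K.comm_inv_char [of ?s ?t] by (auto simp: inv0_def)
qed

section \<open>Triangles, tetrahedra and the action of \<open>S4\<close>\<close>

definition w where "w a b c = \<sigma> (inv a \<otimes> b) (inv b \<otimes> c)"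

lemma w_closed [simp]:
  "a \<in> carrier G \<Longrightarrow> b \<in> carrier G \<Longrightarrow> c \<in> carrier G \<Longrightarrow> w a b c \<in> carrier K"
  by (simp add: w_def)

lemma inv_mult_cancel:
  assumes "a \<in> carrier G" "b \<in> carrier G" "c \<in> carrier G"
  shows "inv a \<otimes> b \<otimes> (inv b \<otimes> c) = inv a \<otimes> c"
  using assms G.m_assoc [of "inv a \<otimes> b" "inv b" c] by (simp add: G.m_assoc)

lemma w_rotate:
  assumes "a \<in> carrier G" "b \<in> carrier G" "c \<in> carrier G"
  shows "w b c a = w a b c"
  using factor_rotate [of "inv a \<otimes> b" "inv b \<otimes> c"] assms
  by (simp add: w_def G.inv_mult_group inv_mult_cancel)

lemma w_reverse:
  assumes "a \<in> carrier G" "b \<in> carrier G" "c \<in> carrier G"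
  shows "w c b a = inv0 (w a b c)"
  using factor_reverse [of "inv a \<otimes> b" "inv b \<otimes> c"] assms
  by (simp add: w_def G.inv_mult_group)

text \<open>Serves as rewrite rules that bring the vertices of any face into a chosen order.\<close>

lemma w_perms:
  assumes "a \<in> carrier G" "b \<in> carrier G" "c \<in> carrier G"
  shows "w b c a = w a b c" "w c a b = w a b c"
    "w c b a = inv0 (w a b c)" "w b a c = inv0 (w a b c)" "w a c b = inv0 (w a b c)"
  using assms w_rotate [of a b c] w_rotate [of b c a] w_reverse [of a b c]
    w_reverse [of b c a] w_reverse [of c a b] by simp_all

text \<open>The faces traverse each edge once in each direction. Starting vertices and the order of
  the factors follow \<open>bd\<close>.\<close>

definition tetra where
  "tetra u = w (u 0) (u 1) (u 2) \<otimes>\<^bsub>K\<^esub> w (u 0) (u 2) (u 3)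
    \<otimes>\<^bsub>K\<^esub> w (u 3) (u 1) (u 0) \<otimes>\<^bsub>K\<^esub> w (u 3) (u 2) (u 1)" for u :: "nat \<Rightarrow> 'a"

lemma bd_eq_tetra:
  assumes "\<And>i. i \<in> {0, 1, 2, 3} \<Longrightarrow> u i \<in> carrier G"
  shows "bd G K \<sigma> (inv (u 0) \<otimes> u 1, inv (u 1) \<otimes> u 2, inv (u 2) \<otimes> u 3) = tetra u"
  using assms by (simp add: bd_def tetra_def w_def G.inv_mult_group inv_mult_cancel)

lemma tetra_closed [simp]:
  "(\<And>i. i \<in> {0, 1, 2, 3} \<Longrightarrow> u i \<in> carrier G) \<Longrightarrow> tetra u \<in> carrier K"
  by (simp add: tetra_def)

text \<open>The two faces containing both \<open>u i\<close> and \<open>u j\<close> are reversed;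
  the other two are interchanged, again with reversed orientation.\<close>

lemma tetra_transpose:
  assumes u: "\<And>i. i \<in> {0, 1, 2, 3} \<Longrightarrow> u i \<in> carrier G"
    and ij: "i \<in> {0, 1, 2, 3}" "j \<in> {0, 1, 2, 3}" "i \<noteq> j"
  shows "tetra (u \<circ> Transposition.transpose i j) = inv0 (tetra u)"
proof -
  have c: "u 0 \<in> carrier G" "u 1 \<in> carrier G" "u 2 \<in> carrier G" "u 3 \<in> carrier G"
    using u by simp_all
  note p = w_perms [OF c(1,2,3)] w_perms [OF c(1,3,4)] w_perms [OF c(4,2,1)] w_perms [OF c(4,3,2)]
  have cl: "w (u 0) (u 1) (u 2) \<in> carrier K" "w (u 0) (u 2) (u 3) \<in> carrier K"
    "w (u 3) (u 1) (u 0) \<in> carrier K" "w (u 3) (u 2) (u 1) \<in> carrier K"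
    using c by simp_all
  \<comment> \<open>After the case split on \<open>i\<close> and \<open>j\<close>, \<open>p\<close>
    restores the chosen order of every face and commutativity matches the products. The attribute
    \<open>simplified\<close> turns \<open>1\<close> into \<open>Suc 0\<close>, as the simplifier
    does in the goals.\<close>
  from ij show ?thesis
    by (elim insertE emptyE; simp only: tetra_def comp_def)
      (simp_all add: transpose_def p [simplified] cl [simplified] K.m_ac)
qed

text \<open>Each transposition applies \<open>inv0\<close> once, and \<open>inv0\<close> is an
  involution, so only the parity survives.\<close>

lemma tetra_permute:
  assumes p: "p permutes {0, 1, 2, 3}"
    and u: "\<And>i. i \<in> {0, 1, 2, 3} \<Longrightarrow> u i \<in> carrier G"
  shows "tetra (u \<circ> p) = (if evenperm p then tetra u else inv0 (tetra u))"
proof -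
  have "finite {0, 1, 2, 3 :: nat}"
    by simp
  then show ?thesis
    using p
  \<comment> \<open>This induction composes the new transposition on the inner side, so
    \<open>tetra_transpose\<close> applies to the vertices \<open>u \<circ> p\<close>.\<close>
  proof (induction p rule: permutes_rev_induct)
    case id
    then show ?case by (simp add: evenperm_id)
  next
    case (swap i j p)
    have up: "(u \<circ> p) k \<in> carrier G" if "k \<in> {0, 1, 2, 3}" for k
      using u permutes_in_image [OF swap(4)] that by (metis comp_apply)
    have "permutation p"
      using swap(4) by (rule permutes_imp_permutation [rotated]) simp
    then have even: "evenperm (p \<circ> Transposition.transpose i j) \<longleftrightarrow> \<not> evenperm p"
      using swap(3) by (simp add: evenperm_comp permutation_swap_id evenperm_swap)
    have "tetra (u \<circ> (p \<circ> Transposition.transpose i j)) = inv0 (tetra (u \<circ> p))"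
      using tetra_transpose [of "u \<circ> p", OF up swap(1-3)] by (simp add: comp_assoc)
    also have "\<dots> = inv0 (if evenperm p then tetra u else inv0 (tetra u))"
      unfolding swap(5) ..
    also have "\<dots> = (if evenperm (p \<circ> Transposition.transpose i j)
        then tetra u else inv0 (tetra u))"
      unfolding even using tetra_closed [of u, OF u] by simp
    finally show ?case .
  qed
qed

lemma bd_S4_act:
  assumes \<gamma>: "\<gamma> \<in> S4" and x: "x \<in> carrier G" and y: "y \<in> carrier G" and z: "z \<in> carrier G"
  shows "bd G K \<sigma> (S4_act G \<gamma> (x, y, z)) =
    (if evenperm \<gamma> then bd G K \<sigma> (x, y, z) else inv0 (bd G K \<sigma> (x, y, z)))"
proof -
  define u where "u = (\<lambda>i. [\<one>, x, x \<otimes> y, x \<otimes> y \<otimes> z] ! i)"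
  have u_simps: "u 0 = \<one>" "u 1 = x" "u 2 = x \<otimes> y" "u 3 = x \<otimes> y \<otimes> z"
    by (simp_all add: u_def)
  have u: "u i \<in> carrier G" if "i \<in> {0, 1, 2, 3}" for i
    using that x y z by (auto simp: u_def)
  have perm: "\<gamma> permutes {0, 1, 2, 3}"
    using \<gamma> by (simp add: S4_def)
  then have inv: "Hilbert_Choice.inv \<gamma> permutes {0, 1, 2, 3}"
    by (rule permutes_inv)
  have "permutation \<gamma>"
    using perm by (rule permutes_imp_permutation [rotated]) simp
  \<comment> \<open>The action relabels the vertices by the inverse of \<open>\<gamma>\<close>, so
    the parity of that inverse is what counts.\<close>
  then have even: "evenperm (Hilbert_Choice.inv \<gamma>) \<longleftrightarrow> evenperm \<gamma>"
    by (rule evenperm_inv)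
  have v: "(u \<circ> Hilbert_Choice.inv \<gamma>) i \<in> carrier G" if "i \<in> {0, 1, 2, 3}" for i
    using u permutes_in_image [OF inv] that by (metis comp_apply)
  have cancel: "inv g \<otimes> (g \<otimes> h) = h" if "g \<in> carrier G" "h \<in> carrier G" for g h
    using that by (simp add: G.m_assoc [symmetric])
  have "bd G K \<sigma> (S4_act G \<gamma> (x, y, z)) = tetra (u \<circ> Hilbert_Choice.inv \<gamma>)"
    using bd_eq_tetra [of "u \<circ> Hilbert_Choice.inv \<gamma>"] v
    by (simp add: S4_act_def Let_def u_def)
  \<comment> \<open>The successive quotients of the vertices \<open>1, x, xy, xyz\<close> are
    \<open>x\<close>, \<open>y\<close> and \<open>z\<close>.\<close>
  moreover have "bd G K \<sigma> (x, y, z) = tetra u"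
    using bd_eq_tetra [of u, OF u, unfolded u_simps] x y z
    by (simp add: cancel)
  ultimately show ?thesis
    using tetra_permute [of _ u, OF inv u] even by simp
qed

end

theorem proposition7p2:
  fixes K :: "('k, 'c) ring_scheme"
    and G :: "('g, 'b) monoid_scheme"
    and \<sigma> :: "'g \<Rightarrow> 'g \<Rightarrow> 'k"
  assumes "algebraically_closed K"
    and "group G"
    and "\<sigma> \<in> pm TYPE('r) G K"
    and "\<forall>g \<in> carrier G. \<sigma> g (inv\<^bsub>G\<^esub> g) \<in> {\<zero>\<^bsub>K\<^esub>, \<one>\<^bsub>K\<^esub>}"
  shows "\<forall>x \<in> carrier G. \<forall>y \<in> carrier G. \<forall>z \<in> carrier G.
      (\<forall>\<gamma> \<in> A4. bd G K \<sigma> (S4_act G \<gamma> (x, y, z)) = bd G K \<sigma> (x, y, z)) \<and>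
      (bd G K \<sigma> (x, y, z) = \<zero>\<^bsub>K\<^esub> \<longleftrightarrow>
        bd G K \<sigma> (S4_act G (Transposition.transpose 0 2) (x, y, z)) = \<zero>\<^bsub>K\<^esub>) \<and>
      (bd G K \<sigma> (x, y, z) \<noteq> \<zero>\<^bsub>K\<^esub> \<longrightarrow>
        bd G K \<sigma> (S4_act G (Transposition.transpose 0 2) (x, y, z)) =
          inv\<^bsub>K\<^esub> (bd G K \<sigma> (x, y, z)))"
proof -
  obtain R :: "('k, 'r) module" and \<Gamma> where "partial_projective_rep G K R \<Gamma> \<sigma>"
    using assms(3) by (auto simp: pm_def)
  then interpret partial_projective_rep G K R \<Gamma> \<sigma> .
  interpret normalized_partial_projective_rep G K R \<Gamma> \<sigma>
    using assms(4) by unfold_locales blast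
  have transpose: "Transposition.transpose 0 2 \<in> S4" "\<not> evenperm (Transposition.transpose 0 (2 :: nat))"
    by (auto simp: S4_def evenperm_swap intro: permutes_swap_id)
  have bd: "bd G K \<sigma> (x, y, z) \<in> carrier K"
    if "x \<in> carrier G" "y \<in> carrier G" "z \<in> carrier G" for x y z
    using that by (simp add: bd_def)
  \<comment> \<open>While \<open>inv0\<close> stays folded, \<open>inv0_eq_zero_iff\<close> settles
    the equivalence of vanishing; unfolding it afterwards yields the inverse in the nonzero
    case.\<close>
  show ?thesis
    using bd transpose by (simp add: bd_S4_act A4_def) (simp add: inv0_def)
qed

end
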